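(* Let $G,I,J,L,M,N,P,Q,R,S$ be complex numbers and put $$\begin{aligned} A&=I+2L+2N+P+2Q+6R+4S-14,\\ C&=-G-I-J-2L-M-2P-3Q-6R-7S+20,\\ E&=-I-2L-N-Q-3R-S+5,\\ F&=3G-J-M+6N+3P+3Q+12R+9S-30,\\ H&=-L-2N-P-Q-4R-3S+10,\\ K&=-2G-2M-2N-5P-2Q-6R-12S+30, \end{aligned}$$ and assume $C\ne0$. Then for every integer $n\ge0$, $$\begin{aligned} C\,t_n^{3}&=\sum_{k_1+\cdots+k_5=n}\binom{n}{k_1,\dots,k_5}T_{k_1}\cdots T_{k_5}\\ &\quad-\frac{A}{563^2}5^nX_n-\frac{E}{563^2}\sum_{k=0}^n\binom nk4^{n-k}W_{n-k}T_k+\frac{F}{563}\sum_{k=0}^n\binom nkT_k\\ &\quad-G\sum_{k=0}^n\binom nkt_k^{1}T_{n-k}-\frac{H}{563^2}\sum_{k=0}^n\binom nk3^{n-k}2^kV_{n-k}U_k-\frac{I}{563}\sum_{k=0}^n\binom nk3^kV_kt_{n-k}\\ &\quad+\frac{J}{563^2}\sum_{k_1+k_2+k_3=n}\binom{n}{k_1,k_2,k_3}(-1)^{k_1}2^{k_2}Y_{k_1}U_{k_2}\\ &\quad+\frac{K}{563}\sum_{k_1+k_2+k_3=n}\binom{n}{k_1,k_2,k_3}(-1)^{k_1}Y_{k_1}t_{k_2}\\ &\quad-\frac{L}{563}\sum_{k_1+k_2+k_3=n}\binom{n}{k_1,k_2,k_3}3^{k_1}V_{k_1}T_{k_2}T_{k_3}\\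 &\quad+\frac{M}{563}\sum_{k_1+k_2+k_3+k_4=n}\binom{n}{k_1,k_2,k_3,k_4}(-1)^{k_1}Y_{k_1}T_{k_2}T_{k_3}\\ &\quad-\frac{N}{563^2}\sum_{k_1+k_2+k_3=n}\binom{n}{k_1,k_2,k_3}2^{k_1}U_{k_1}2^{k_2}U_{k_2}T_{k_3}\\ &\quad-P\sum_{k_1+k_2+k_3=n}\binom{n}{k_1,k_2,k_3}t_{k_1}t_{k_2}T_{k_3}\\ &\quad-\frac{Q}{563}\sum_{k_1+k_2+k_3=n}\binom{n}{k_1,k_2,k_3}2^{k_1}U_{k_1}t_{k_2}T_{k_3}\\ &\quad-\frac{R}{563}\sum_{k_1+k_2+k_3+k_4=n}\binom{n}{k_1,k_2,k_3,k_4}2^{k_1}U_{k_1}T_{k_2}T_{k_3}T_{k_4}\\ &\quad-S\sum_{k_1+k_2+k_3+k_4=n}\binom{n}{k_1,k_2,k_3,k_4}t_{k_1}T_{k_2}T_{k_3}T_{k_4}. \end{aligned}$$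
   Context: For given $s_0,s_1,s_2,s_3$, the sequence $T_n^{(s_0,s_1,s_2,s_3)}$ is defined by $T_j^{(s_0,s_1,s_2,s_3)}=s_j$ for $0\le j\le 3$ and, for $n\ge4$, each term being the sum of the four preceding terms. The Tetranacci numbers are $T_n=T_n^{(0,1,1,2)}$. Abbreviate $U_n=T_n^{(40,64,215,344)}$, $V_n=T_n^{(15,27,48,107)}$, $W_n=T_n^{(3052,4658,8804,16451)}$, $X_n=T_n^{(500,1423,2598,4986)}$, $Y_n=T_n^{(-5,2,13,32)}$, and $$t_n=\frac12\left(\sum_{k=0}^n\binom nkT_kT_{n-k}-\frac{2^n}{563}U_n\right).$$ All indices $k_i$ in sums run over nonnegative integers and $\binom{n}{k_1,\dots,k_r}=\frac{n!}{k_1!\cdots k_r!}$. Let $\lambda_1,\lambda_2,\lambda_3,\lambda_4$ be the (distinct, complex) roots of $x^4-x^3-x^2-x-1=0$ and $c_i=\frac1{-\lambda_i^3+6\lambda_i-1}$ (so $\sum_{n\ge0}T_n\frac{x^n}{n!}=\sum_{i=1}^4c_ie^{\lambda_ix}$). The numbers $t_n^1$, $t_n^3$ (superscripts are indices, not powers) are defined by $$\sum_{n=0}^\infty t_n^{1}\frac{x^n}{n!}=\sum_{1\le i<j<l\le4}c_ic_jc_le^{(\lambda_i+\lambda_j+\lambda_l)x}\left(c_ie^{\lambda_ix}+c_je^{\lambda_jx}+c_le^{\lambda_lx}\right),$$ $$\sum_{n=0}^\infty t_n^{3}\frac{x^n}{n!}=\sum_{1\le i<j<l\le4}c_ic_jc_le^{(\lambda_i+\lambda_j+\lambda_l)x}\left(c_i^2e^{2\lambda_ix}+c_j^2e^{2\lambda_jx}+c_l^2e^{2\lambda_lx}\right).$$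 *)

theory Defs
  imports Complex_Main "HOL-Computational_Algebra.Formal_Power_Series"
begin

fun gen_tetranacci :: "complex \<Rightarrow> complex \<Rightarrow> complex \<Rightarrow> complex \<Rightarrow> nat \<Rightarrow> complex" where
  "gen_tetranacci s0 s1 s2 s3 0 = s0"
| "gen_tetranacci s0 s1 s2 s3 (Suc 0) = s1"
| "gen_tetranacci s0 s1 s2 s3 (Suc (Suc 0)) = s2"
| "gen_tetranacci s0 s1 s2 s3 (Suc (Suc (Suc 0))) = s3"
| "gen_tetranacci s0 s1 s2 s3 (Suc (Suc (Suc (Suc n)))) =
     gen_tetranacci s0 s1 s2 s3 (Suc (Suc (Suc n))) + gen_tetranacci s0 s1 s2 s3 (Suc (Suc n))
     + gen_tetranacci s0 s1 s2 s3 (Suc n) + gen_tetranacci s0 s1 s2 s3 n"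

abbreviation tetT :: "nat \<Rightarrow> complex" where
  "tetT \<equiv> gen_tetranacci 0 1 1 2"

abbreviation tetU :: "nat \<Rightarrow> complex" where
  "tetU \<equiv> gen_tetranacci 40 64 215 344"

abbreviation tetV :: "nat \<Rightarrow> complex" where
  "tetV \<equiv> gen_tetranacci 15 27 48 107"

abbreviation tetW :: "nat \<Rightarrow> complex" where
  "tetW \<equiv> gen_tetranacci 3052 4658 8804 16451"

abbreviation tetX :: "nat \<Rightarrow> complex" where
  "tetX \<equiv> gen_tetranacci 500 1423 2598 4986"

abbreviation tetY :: "nat \<Rightarrow> complex" where
  "tetY \<equiv> gen_tetranacci (-5) 2 13 32"

definition tet_t :: "nat \<Rightarrow> complex" where
  "tet_t n = 1 / 2 * ((\<Sum>k=0..n. of_nat (n choose k) * tetT k * tetT (n - k)) - 2 ^ n / 563 * tetU n)"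

text \<open>The multinomial coefficient; only used with the entries of \<open>ks\<close> summing to \<open>n\<close>.\<close>
definition multinom :: "nat \<Rightarrow> nat list \<Rightarrow> complex" where
  "multinom n ks = fact n / (\<Prod>k\<leftarrow>ks. fact k)"

text \<open>At a root \<open>z\<close> of \<open>x^4 - x^3 - x^2 - x - 1\<close>, the coefficient of \<open>exp (z * x)\<close> in the
  exponential generating function of \<open>tetT\<close>.\<close>
definition tet_c :: "complex \<Rightarrow> complex" where
  "tet_c z = 1 / (- (z ^ 3) + 6 * z - 1)"

definition egf :: "(nat \<Rightarrow> complex) \<Rightarrow> complex fps" where
  "egf a = Abs_fps (\<lambda>n. a n / fact n)"

end

theory Submission
  imports Defs "HOL-Computational_Algebra.Polynomial"
begin

text \<open>
  Write \<open>a_i = c_i e^(\<lambda>_i x)\<close> for the four summands of the exponential generating function of \<open>T\<close>.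
  All sums in the theorem are coefficients of symmetric polynomials of degree 5 in
  \<open>a_1, ..., a_4\<close>, and the theorem is one identity between such polynomials.

  The dictionary is as follows, with \<open>p_k\<close> the power sums and \<open>e_k\<close> the elementary symmetric
  functions of the \<open>a_i\<close>. The sequences \<open>T\<close>, \<open>2^n U / 563\<close>, \<open>3^n V / 563\<close>, \<open>4^n W / 563^2\<close> and
  \<open>5^n X / 563^2\<close> have the generating functions \<open>p_1, ..., p_5\<close>; here the initial values come from
  writing each power of \<open>c_i\<close> as a cubic polynomial in \<open>\<lambda>_i\<close> and summing with the power sums of the
  roots (\<open>tet_c_powers_eq_cubic\<close>, \<open>root_sum_eq_gen_tetranacci\<close>). From \<open>p_1^2 - p_2 = 2 e_2\<close> the
  generating function of \<open>t\<close> is \<open>e_2\<close>. Since the roots add up to 1 and the \<open>c_i\<close> multiply to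
  \<open>-1/563\<close>, we have \<open>e_4 = -e^x / 563\<close>; dividing by one \<open>a_i\<close> at a time gives
  \<open>e_3 = -(e^x / 563) (1/c_1 e^(-\<lambda>_1 x) + ... + 1/c_4 e^(-\<lambda>_4 x))\<close>, and the sum in parentheses is the
  generating function of \<open>(-1)^n Y\<close>. Finally \<open>t1\<close> and \<open>t3\<close> belong to the monomial symmetric functions
  \<open>m_211\<close> and \<open>m_311\<close>. Multinomial sums are products of generating functions.

  In four variables the symmetric polynomials of degree 5 have dimension 6, one for each partition
  of 5 into at most four parts, and \<open>p_5, p_4 p_1, e_4 p_1, p_3 p_2, e_3 e_2, m_311\<close> form a basis.
  The other products in the theorem are \<open>p_1^5\<close>, whose coefficient is 1, and ten more with free
  coefficients \<open>G, I, J, L, ..., S\<close>. The numbers \<open>A, E, F, H, K, C\<close> are the coordinates of the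
  resulting combination in this basis (\<open>symmetric_relation\<close>).
\<close>

section \<open>Symmetric functions of four quantities\<close>

lemma newton_identities_four:
  fixes a b c d :: "'a :: idom"
  defines "e1 \<equiv> a + b + c + d"
    and "e2 \<equiv> a*b + a*c + a*d + b*c + b*d + c*d"
    and "e3 \<equiv> a*b*c + a*b*d + a*c*d + b*c*d"
    and "e4 \<equiv> a*b*c*d"
  shows "a^2 + b^2 + c^2 + d^2 = e1^2 - 2*e2"
    and "a^3 + b^3 + c^3 + d^3 = e1^3 - 3*e1*e2 + 3*e3"
    and "a^4 + b^4 + c^4 + d^4 = e1^4 - 4*e1^2*e2 + 2*e2^2 + 4*e1*e3 - 4*e4"
    and "a^5 + b^5 + c^5 + d^5 =
           e1^5 - 5*e1^3*e2 + 5*e1*e2^2 + 5*e1^2*e3 - 5*e2*e3 - 5*e1*e4"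
  unfolding e1_def e2_def e3_def e4_def by algebra+

lemma triple_sums_four:
  fixes a b c d :: "'a :: idom"
  defines "e1 \<equiv> a + b + c + d"
    and "e2 \<equiv> a*b + a*c + a*d + b*c + b*d + c*d"
    and "e3 \<equiv> a*b*c + a*b*d + a*c*d + b*c*d"
    and "e4 \<equiv> a*b*c*d"
  shows "a*b*c*(a + b + c) + a*b*d*(a + b + d) + a*c*d*(a + c + d) + b*c*d*(b + c + d)
           = e1*e3 - 4*e4"
    and "a*b*c*(a^2 + b^2 + c^2) + a*b*d*(a^2 + b^2 + d^2) + a*c*d*(a^2 + c^2 + d^2)
           + b*c*d*(b^2 + c^2 + d^2) = e1^2*e3 - 2*e2*e3 - e1*e4"
  unfolding e1_def e2_def e3_def e4_def by algebra+

text \<open>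
  Once the power sums are expressed by Newton's identities, this is an identity of polynomials in
  the independent variables \<open>e1, ..., e4\<close>, much smaller than its expansion in the four original
  variables.
\<close>
lemma degree_five_relation:
  fixes e1 e2 e3 e4 G I J L M N P Q R S :: "'a :: idom"
  defines "p2 \<equiv> e1^2 - 2*e2"
    and "p3 \<equiv> e1^3 - 3*e1*e2 + 3*e3"
    and "p4 \<equiv> e1^4 - 4*e1^2*e2 + 2*e2^2 + 4*e1*e3 - 4*e4"
    and "p5 \<equiv> e1^5 - 5*e1^3*e2 + 5*e1*e2^2 + 5*e1^2*e3 - 5*e2*e3 - 5*e1*e4"
  shows "(- G - I - J - 2*L - M - 2*P - 3*Q - 6*R - 7*S + 20)
      * (e1^2*e3 - 2*e2*e3 - e1*e4) =
    e1^5 - (I + 2*L + 2*N + P + 2*Q + 6*R + 4*S - 14) * p5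
    - (- I - 2*L - N - Q - 3*R - S + 5) * (p4*e1)
    - (3*G - J - M + 6*N + 3*P + 3*Q + 12*R + 9*S - 30) * (e4*e1)
    - G * ((e1*e3 - 4*e4)*e1)
    - (- L - 2*N - P - Q - 4*R - 3*S + 10) * (p3*p2)
    - I * (p3*e2) - J * (e3*p2)
    - (- 2*G - 2*M - 2*N - 5*P - 2*Q - 6*R - 12*S + 30) * (e3*e2)
    - L * (p3*e1^2) - M * (e3*e1^2) - N * (p2^2*e1) - P * (e2^2*e1)
    - Q * (p2*e2*e1) - R * (p2*e1^3) - S * (e2*e1^3)"
  unfolding p2_def p3_def p4_def p5_def by algebra

text \<open>
  The coefficients on \<open>m311, p5, p4*p1, e4*p1, p3*p2, e3*e2\<close> are forced by the ten parameters:
  these six products are linearly independent, and they span all the others. For example, \<open>a^5\<close>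
  occurs exactly in the products of power sums, once in each, so that the coefficients subtracted
  with \<open>p5, p4*p1, p3*p2, p3*p1^2, p2^2*p1, p2*p1^3\<close> must add up to 1, the coefficient of \<open>p1^5\<close>.
\<close>
lemma symmetric_relation:
  fixes a b c d G I J L M N P Q R S :: "'a :: idom"
  defines "e2 \<equiv> a*b + a*c + a*d + b*c + b*d + c*d"
    and "e3 \<equiv> a*b*c + a*b*d + a*c*d + b*c*d"
    and "e4 \<equiv> a*b*c*d"
    and "p1 \<equiv> a + b + c + d"
    and "p2 \<equiv> a^2 + b^2 + c^2 + d^2"
    and "p3 \<equiv> a^3 + b^3 + c^3 + d^3"
    and "p4 \<equiv> a^4 + b^4 + c^4 + d^4"
    and "p5 \<equiv> a^5 + b^5 + c^5 + d^5"
    and "m211 \<equiv> a*b*c*(a + b + c) + a*b*d*(a + b + d) + a*c*d*(a + c + d) + b*c*d*(b + c + d)"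
    and "m311 \<equiv> a*b*c*(a^2 + b^2 + c^2) + a*b*d*(a^2 + b^2 + d^2) + a*c*d*(a^2 + c^2 + d^2)
           + b*c*d*(b^2 + c^2 + d^2)"
  shows "(- G - I - J - 2*L - M - 2*P - 3*Q - 6*R - 7*S + 20) * m311 =
    p1^5 - (I + 2*L + 2*N + P + 2*Q + 6*R + 4*S - 14) * p5
    - (- I - 2*L - N - Q - 3*R - S + 5) * (p4*p1)
    - (3*G - J - M + 6*N + 3*P + 3*Q + 12*R + 9*S - 30) * (e4*p1)
    - G * (m211*p1)
    - (- L - 2*N - P - Q - 4*R - 3*S + 10) * (p3*p2)
    - I * (p3*e2) - J * (e3*p2)
    - (- 2*G - 2*M - 2*N - 5*P - 2*Q - 6*R - 12*S + 30) * (e3*e2)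
    - L * (p3*p1^2) - M * (e3*p1^2) - N * (p2^2*p1) - P * (e2^2*p1)
    - Q * (p2*e2*p1) - R * (p2*p1^3) - S * (e2*p1^3)"
  unfolding e2_def e3_def e4_def p1_def p2_def p3_def p4_def p5_def m211_def m311_def
    newton_identities_four triple_sums_four
  by (rule degree_five_relation)

section \<open>Products of exponential generating functions\<close>

lemma fps_nth_egf [simp]: "fps_nth (egf a) n = a n / fact n"
  by (simp add: egf_def)

lemma finite_sum_eq_nat:
  fixes size :: "'b \<Rightarrow> nat"
  assumes "\<And>m. finite {r. size r = m}"
  shows "finite {(k, r). k + size r = n}"
proof -
  have "{(k, r). k + size r = n} = (SIGMA k:{0..n}. {r. size r = n - k})"
    by auto
  then show ?thesis using assms by simp
qed

text \<open>
  Peels one factor off a Cauchy product. The indices of the remaining factors form a tuple \<open>r\<close>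
  with total \<open>size r\<close>, so that repeated use builds up the sums over tuples.
\<close>
lemma fps_nth_mult_sum:
  fixes f h :: "'a :: comm_ring_1 fps" and size :: "'b \<Rightarrow> nat"
  assumes fin: "\<And>m. finite {r. size r = m}"
    and h: "\<And>m. fps_nth h m = (\<Sum>r \<in> {r. size r = m}. \<phi> r)"
  shows "fps_nth (f * h) n = (\<Sum>(k, r) \<in> {(k, r). k + size r = n}. fps_nth f k * \<phi> r)"
proof -
  have "{(k, r). k + size r = n} = (SIGMA k:{0..n}. {r. size r = n - k})"
    by auto
  then show ?thesis
    using fin by (simp add: fps_mult_nth h sum_distrib_left sum.Sigma)
qed

lemma finite_sums:
  "finite {(k1, k2). k1 + k2 = (n :: nat)}"
  "finite {(k1, k2, k3). k1 + k2 + k3 = (n :: nat)}"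
  "finite {(k1, k2, k3, k4). k1 + k2 + k3 + k4 = (n :: nat)}"
proof -
  show 2: "finite {(k1, k2). k1 + k2 = n}" for n :: nat
    using finite_sum_eq_nat[of "\<lambda>k. k" n] by simp
  show 3: "finite {(k1, k2, k3). k1 + k2 + k3 = n}" for n :: nat
    using finite_sum_eq_nat[of "\<lambda>(k1, k2). k1 + k2" n] 2
    by (simp add: case_prod_unfold add.assoc)
  show "finite {(k1, k2, k3, k4). k1 + k2 + k3 + k4 = n}"
    using finite_sum_eq_nat[of "\<lambda>(k1, k2, k3). k1 + k2 + k3" n] 3
    by (simp add: case_prod_unfold add.assoc)
qed

lemma fps_nth_mult2:
  fixes f g :: "'a :: comm_ring_1 fps"
  shows "fps_nth (f * g) n = (\<Sum>(k1, k2) \<in> {(k1, k2). k1 + k2 = n}. fps_nth f k1 * fps_nth g k2)"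
  using fps_nth_mult_sum[of "\<lambda>k. k" g "fps_nth g" f n] by simp

lemma fps_nth_mult3:
  fixes f g h :: "'a :: comm_ring_1 fps"
  shows "fps_nth (f * g * h) n =
    (\<Sum>(k1, k2, k3) \<in> {(k1, k2, k3). k1 + k2 + k3 = n}.
      fps_nth f k1 * fps_nth g k2 * fps_nth h k3)"
  using fps_nth_mult_sum[where size = "\<lambda>(k2, k3). k2 + k3" and h = "g * h"
      and \<phi> = "\<lambda>(k2, k3). fps_nth g k2 * fps_nth h k3" and f = f and n = n]
    finite_sums(1) fps_nth_mult2[of g h]
  by (simp add: case_prod_unfold add.assoc mult.assoc)

lemma fps_nth_mult4:
  fixes f g h u :: "'a :: comm_ring_1 fps"
  shows "fps_nth (f * g * h * u) n =
    (\<Sum>(k1, k2, k3, k4) \<in> {(k1, k2, k3, k4). k1 + k2 + k3 + k4 = n}.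
      fps_nth f k1 * fps_nth g k2 * fps_nth h k3 * fps_nth u k4)"
  using fps_nth_mult_sum[where size = "\<lambda>(k2, k3, k4). k2 + k3 + k4" and h = "g * h * u"
      and \<phi> = "\<lambda>(k2, k3, k4). fps_nth g k2 * fps_nth h k3 * fps_nth u k4" and f = f and n = n]
    finite_sums(2) fps_nth_mult3[of g h u]
  by (simp add: case_prod_unfold add.assoc mult.assoc)

lemma fps_nth_mult5:
  fixes f g h u v :: "'a :: comm_ring_1 fps"
  shows "fps_nth (f * g * h * u * v) n =
    (\<Sum>(k1, k2, k3, k4, k5) \<in> {(k1, k2, k3, k4, k5). k1 + k2 + k3 + k4 + k5 = n}.
      fps_nth f k1 * fps_nth g k2 * fps_nth h k3 * fps_nth u k4 * fps_nth v k5)"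
  using fps_nth_mult_sum[where size = "\<lambda>(k2, k3, k4, k5). k2 + k3 + k4 + k5" and h = "g * h * u * v"
      and \<phi> = "\<lambda>(k2, k3, k4, k5). fps_nth g k2 * fps_nth h k3 * fps_nth u k4 * fps_nth v k5" and f = f and n = n]
    finite_sums(3) fps_nth_mult4[of g h u v]
  by (simp add: case_prod_unfold add.assoc mult.assoc)

lemma egf_one: "egf (\<lambda>_. 1) = fps_exp 1"
  by (rule fps_ext) simp


lemma binomial_sum_eq_egf:
  "(\<Sum>k=0..n. of_nat (n choose k) * (a k * b (n - k))) = fact n * fps_nth (egf a * egf b) n"
  unfolding fps_mult_nth sum_distrib_left
  by (intro sum.cong) (auto simp: binomial_fact)

lemma multinomial_sum3_eq_egf:
  "(\<Sum>(k1, k2, k3) \<in> {(k1, k2, k3). k1 + k2 + k3 = n}.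
      multinom n [k1, k2, k3] * (a k1 * b k2 * c k3)) = fact n * fps_nth (egf a * egf b * egf c) n"
  unfolding fps_nth_mult3 sum_distrib_left
  by (intro sum.cong) (auto simp: multinom_def)

lemma multinomial_sum4_eq_egf:
  "(\<Sum>(k1, k2, k3, k4) \<in> {(k1, k2, k3, k4). k1 + k2 + k3 + k4 = n}.
      multinom n [k1, k2, k3, k4] * (a k1 * b k2 * c k3 * d k4))
    = fact n * fps_nth (egf a * egf b * egf c * egf d) n"
  unfolding fps_nth_mult4 sum_distrib_left
  by (intro sum.cong) (auto simp: multinom_def)

lemma multinomial_sum5_eq_egf:
  "(\<Sum>(k1, k2, k3, k4, k5) \<in> {(k1, k2, k3, k4, k5). k1 + k2 + k3 + k4 + k5 = n}.
      multinom n [k1, k2, k3, k4, k5] * (a k1 * b k2 * c k3 * d k4 * e k5))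
    = fact n * fps_nth (egf a * egf b * egf c * egf d * egf e) n"
  unfolding fps_nth_mult5 sum_distrib_left
  by (intro sum.cong) (auto simp: multinom_def)

section \<open>Root sums and Tetranacci sequences\<close>

lemma gen_tetranacci_unique:
  assumes "\<And>n. f (n + 4) = f (n + 3) + f (n + 2) + f (n + 1) + f n"
  shows "f n = gen_tetranacci (f 0) (f 1) (f 2) (f 3) n"
proof (induction "f 0" "f 1" "f 2" "f 3" n rule: gen_tetranacci.induct)
qed (use assms in \<open>simp_all add: numeral_eq_Suc\<close>)

text \<open>
  The second factor is the inverse of the first one in \<open>\<rat>[z] / (z^4 - z^3 - z^2 - z - 1)\<close>, up to the
  scalar 563. This number is the absolute value of the norm of the first factor.
\<close>
lemma tet_c_denominator:
  fixes z :: complex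
  assumes "z ^ 4 - z ^ 3 - z ^ 2 - z - 1 = 0"
  shows "(- (z ^ 3) + 6 * z - 1) * (-87 - 71 * z - 61 * z^2 + 86 * z^3) = 563"
  using assms by algebra

text \<open>
  The cubics are the reductions of the powers of the first one modulo the quartic. With them,
  symmetric sums of the values \<open>tet_c z\<close> over the roots reduce to power sums of the roots.
\<close>
lemma tet_c_powers_eq_cubic:
  fixes z :: complex
  assumes z: "z ^ 4 - z ^ 3 - z ^ 2 - z - 1 = 0"
  shows "tet_c z = (-87 - 71 * z - 61 * z^2 + 86 * z^3) / 563"
    and "tet_c z ^ 2 = (6 + 9 * z + 28 * z^2 - 11 * z^3) / 563"
    and "tet_c z ^ 3 = (512 + 1958 * z - 1220 * z^2 + 1157 * z^3) / 563^2"
    and "tet_c z ^ 4 = (248 - 175 * z + 255 * z^2 + 210 * z^3) / 563^2"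
    and "tet_c z ^ 5 = (-21851 + 24522 * z + 20077 * z^2 + 40593 * z^3) / 563^3"
proof -
  have c: "563 * tet_c z = -87 - 71 * z - 61 * z^2 + 86 * z^3"
    using tet_c_denominator[OF z] unfolding tet_c_def by (auto simp: divide_simps mult.commute)
  have c2: "563 * tet_c z ^ 2 = 6 + 9 * z + 28 * z^2 - 11 * z^3"
    using c z by algebra
  have c3: "563^2 * tet_c z ^ 3 = 512 + 1958 * z - 1220 * z^2 + 1157 * z^3"
    using c c2 z by algebra
  have c4: "563^2 * tet_c z ^ 4 = 248 - 175 * z + 255 * z^2 + 210 * z^3"
    using c2 z by algebra
  have c5: "563^3 * tet_c z ^ 5 = -21851 + 24522 * z + 20077 * z^2 + 40593 * z^3"
    using c2 c3 z by algebra
  show "tet_c z = (-87 - 71 * z - 61 * z^2 + 86 * z^3) / 563"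
    using c by (simp add: eq_divide_eq mult.commute)
  show "tet_c z ^ 2 = (6 + 9 * z + 28 * z^2 - 11 * z^3) / 563"
    using c2 by (simp add: eq_divide_eq mult.commute)
  show "tet_c z ^ 3 = (512 + 1958 * z - 1220 * z^2 + 1157 * z^3) / 563^2"
    using c3 by (simp add: eq_divide_eq mult.commute)
  show "tet_c z ^ 4 = (248 - 175 * z + 255 * z^2 + 210 * z^3) / 563^2"
    using c4 by (simp add: eq_divide_eq mult.commute)
  show "tet_c z ^ 5 = (-21851 + 24522 * z + 20077 * z^2 + 40593 * z^3) / 563^3"
    using c5 by (simp add: eq_divide_eq mult.commute)
qed

lemma sum_upto_4: "(\<Sum>i=1..4. f i) = f 1 + f 2 + f 3 + f (4 :: nat)"
  by (simp add: numeral_eq_Suc)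

lemma triple_indices:
  "(\<Sum>(i, j, l) \<in> {(i, j, l). 1 \<le> i \<and> i < j \<and> j < l \<and> l \<le> (4 :: nat)}. f i j l) =
    f 1 2 3 + f 1 2 4 + f 1 3 4 + f 2 3 4"
proof -
  have "{(i, j, l). 1 \<le> i \<and> i < j \<and> j < l \<and> l \<le> (4 :: nat)} =
      {(1, 2, 3), (1, 2, 4), (1, 3, 4), (2, 3, 4)}"
    by auto
  then show ?thesis by (simp add: add.assoc)
qed

locale tetranacci_roots =
  fixes lam :: "nat \<Rightarrow> complex"
  assumes lam: "bij_betw lam {1..4} {z. z ^ 4 - z ^ 3 - z ^ 2 - z - 1 = 0}"
begin

lemma root: "i \<in> {1..4} \<Longrightarrow> lam i ^ 4 - lam i ^ 3 - lam i ^ 2 - lam i - 1 = 0"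
  using bij_betwE[OF lam] by blast

text \<open>
  The difference of the two sides has degree at most 3 but vanishes at four distinct points.
\<close>
lemma poly_factorization:
  "[:-1, -1, -1, -1, 1:] = [:- lam 1, 1:] * [:- lam 2, 1:] * [:- lam 3, 1:] * [:- lam 4, 1:]"
  (is "?p = ?q")
proof (rule ccontr)
  define r where "r = ?p - ?q"
  assume "?p \<noteq> ?q"
  then have "r \<noteq> 0" by (simp add: r_def)
  have "degree r \<le> 3"
    by (rule degree_le) (auto simp: r_def coeff_pCons algebra_simps split: nat.splits)
  have "poly r (lam i) = 0" if "i \<in> {1..4}" for i
  proof -
    have "i = 1 \<or> i = 2 \<or> i = 3 \<or> i = 4" using that by auto
    then show ?thesis using root[OF that]
      by (auto simp: r_def algebra_simps power_numeral_reduce)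
  qed
  then have "lam ` {1..4} \<subseteq> {z. poly r z = 0}" by auto
  then have "card (lam ` {1..4}) \<le> card {z. poly r z = 0}"
    using poly_roots_finite[OF \<open>r \<noteq> 0\<close>] by (rule card_mono[rotated])
  also have "\<dots> \<le> degree r" using \<open>r \<noteq> 0\<close> by (rule card_poly_roots_bound)
  finally show False
    using \<open>degree r \<le> 3\<close> card_image[OF bij_betw_imp_inj_on[OF lam]] by simp
qed

lemma vieta:
  "lam 1 + lam 2 + lam 3 + lam 4 = 1"
  "lam 1 * lam 2 + lam 1 * lam 3 + lam 1 * lam 4 + lam 2 * lam 3 + lam 2 * lam 4 + lam 3 * lam 4 = -1"
  "lam 1 * lam 2 * lam 3 + lam 1 * lam 2 * lam 4 + lam 1 * lam 3 * lam 4 + lam 2 * lam 3 * lam 4 = 1"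
proof -
  note p = poly_factorization[simplified]
  show "lam 1 + lam 2 + lam 3 + lam 4 = 1"
    using p by (simp, algebra)
  show "lam 1 * lam 2 + lam 1 * lam 3 + lam 1 * lam 4 + lam 2 * lam 3 + lam 2 * lam 4 + lam 3 * lam 4 = -1"
    using p by (simp, algebra)
  show "lam 1 * lam 2 * lam 3 + lam 1 * lam 2 * lam 4 + lam 1 * lam 3 * lam 4 + lam 2 * lam 3 * lam 4 = 1"
    using p by (simp, algebra)
qed

lemma power_sums:
  "(\<Sum>i=1..4. lam i) = 1" "(\<Sum>i=1..4. lam i ^ 2) = 3" "(\<Sum>i=1..4. lam i ^ 3) = 7"
  using newton_identities_four(1,2)[of "lam 1" "lam 2" "lam 3" "lam 4"]
  unfolding vieta sum_upto_4 by simp_all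

lemma root_power_add_4:
  assumes "i \<in> {1..4}"
  shows "lam i ^ (n + 4) = lam i ^ (n + 3) + lam i ^ (n + 2) + lam i ^ (n + 1) + lam i ^ n"
proof -
  have "lam i ^ 4 = lam i ^ 3 + lam i ^ 2 + lam i + 1"
    using root[OF assms] by (simp add: algebra_simps)
  then show ?thesis
    by (simp add: power_add algebra_simps power2_eq_square)
qed

lemma power_sums_higher:
  "(\<Sum>i=1..4. lam i ^ 4) = 15" "(\<Sum>i=1..4. lam i ^ 5) = 26" "(\<Sum>i=1..4. lam i ^ 6) = 51"
proof -
  have rec: "(\<Sum>i=1..4. lam i ^ (n + 4)) = (\<Sum>i=1..4. lam i ^ (n + 3)) + (\<Sum>i=1..4. lam i ^ (n + 2))
      + (\<Sum>i=1..4. lam i ^ (n + 1)) + (\<Sum>i=1..4. lam i ^ n)" for n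
    by (simp add: root_power_add_4 sum.distrib)
  show 4: "(\<Sum>i=1..4. lam i ^ 4) = 15"
    using rec[of 0] power_sums by (simp add: power2_eq_square power3_eq_cube mult.assoc)
  show 5: "(\<Sum>i=1..4. lam i ^ 5) = 26"
    using rec[of 1] power_sums 4 by (simp add: power2_eq_square power3_eq_cube mult.assoc)
  show "(\<Sum>i=1..4. lam i ^ 6) = 51"
    using rec[of 2] power_sums 4 5 by (simp add: power2_eq_square power3_eq_cube mult.assoc)
qed

text \<open>
  The sum satisfies the recurrence since each root power does. The coefficients in its initial
  values are the power sums \<open>4, 1, 3, 7, 15, 26, 51\<close> of the roots.
\<close>
lemma root_sum_eq_gen_tetranacci:
  assumes d: "\<And>i. i \<in> {1..4} \<Longrightarrow> d i = d0 + d1 * lam i + d2 * lam i ^ 2 + d3 * lam i ^ 3"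
  shows "(\<Sum>i=1..4. d i * lam i ^ n) = gen_tetranacci
    (4 * d0 + d1 + 3 * d2 + 7 * d3) (d0 + 3 * d1 + 7 * d2 + 15 * d3)
    (3 * d0 + 7 * d1 + 15 * d2 + 26 * d3) (7 * d0 + 15 * d1 + 26 * d2 + 51 * d3) n"
proof -
  define f where "f n = (\<Sum>i=1..4. d i * lam i ^ n)" for n
  have "f (n + 4) = f (n + 3) + f (n + 2) + f (n + 1) + f n" for n
    unfolding f_def sum.distrib[symmetric]
    by (intro sum.cong refl) (simp add: root_power_add_4 algebra_simps)
  then have "f n = gen_tetranacci (f 0) (f 1) (f 2) (f 3) n"
    by (rule gen_tetranacci_unique)
  moreover have f: "f j = d0 * (\<Sum>i=1..4. lam i ^ j) + d1 * (\<Sum>i=1..4. lam i ^ (j + 1))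
      + d2 * (\<Sum>i=1..4. lam i ^ (j + 2)) + d3 * (\<Sum>i=1..4. lam i ^ (j + 3))" for j
    unfolding f_def sum_distrib_left sum.distrib[symmetric]
    by (intro sum.cong refl) (simp add: d algebra_simps power_add power2_eq_square power3_eq_cube)
  have "f 0 = 4 * d0 + d1 + 3 * d2 + 7 * d3"
    using f[of 0] power_sums by (simp add: power2_eq_square power3_eq_cube mult.assoc)
  moreover have "f 1 = d0 + 3 * d1 + 7 * d2 + 15 * d3"
    using f[of 1] power_sums power_sums_higher by (simp add: power2_eq_square power3_eq_cube mult.assoc)
  moreover have "f 2 = 3 * d0 + 7 * d1 + 15 * d2 + 26 * d3"
    using f[of 2] power_sums power_sums_higher by (simp add: power2_eq_square power3_eq_cube mult.assoc)
  moreover have "f 3 = 7 * d0 + 15 * d1 + 26 * d2 + 51 * d3"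
    using f[of 3] power_sums power_sums_higher by (simp add: power2_eq_square power3_eq_cube mult.assoc)
  ultimately show ?thesis by (simp add: f_def)
qed

lemma tetT_root_sum: "(\<Sum>i=1..4. tet_c (lam i) * lam i ^ n) = tetT n"
  by (subst root_sum_eq_gen_tetranacci[where ?d0.0 = "-87/563" and ?d1.0 = "-71/563"
      and ?d2.0 = "-61/563" and ?d3.0 = "86/563"])
    (simp_all add: tet_c_powers_eq_cubic(1)[OF root] field_simps)

lemma tetU_root_sum: "(\<Sum>i=1..4. 563 * tet_c (lam i) ^ 2 * lam i ^ n) = tetU n"
  by (subst root_sum_eq_gen_tetranacci[where ?d0.0 = 6 and ?d1.0 = 9
      and ?d2.0 = 28 and ?d3.0 = "-11"])
    (simp_all add: tet_c_powers_eq_cubic(2)[OF root] field_simps)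

lemma tetV_root_sum: "(\<Sum>i=1..4. 563 * tet_c (lam i) ^ 3 * lam i ^ n) = tetV n"
  by (subst root_sum_eq_gen_tetranacci[where ?d0.0 = "512/563" and ?d1.0 = "1958/563"
      and ?d2.0 = "-1220/563" and ?d3.0 = "1157/563"])
    (simp_all add: tet_c_powers_eq_cubic(3)[OF root] field_simps)

lemma tetW_root_sum: "(\<Sum>i=1..4. 563^2 * tet_c (lam i) ^ 4 * lam i ^ n) = tetW n"
  by (subst root_sum_eq_gen_tetranacci[where ?d0.0 = 248 and ?d1.0 = "-175"
      and ?d2.0 = 255 and ?d3.0 = 210])
    (simp_all add: tet_c_powers_eq_cubic(4)[OF root] field_simps)

lemma tetX_root_sum: "(\<Sum>i=1..4. 563^2 * tet_c (lam i) ^ 5 * lam i ^ n) = tetX n"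
  by (subst root_sum_eq_gen_tetranacci[where ?d0.0 = "-21851/563" and ?d1.0 = "24522/563"
      and ?d2.0 = "20077/563" and ?d3.0 = "40593/563"])
    (simp_all add: tet_c_powers_eq_cubic(5)[OF root] field_simps)

lemma tet_c_nonzero: "i \<in> {1..4} \<Longrightarrow> tet_c (lam i) \<noteq> 0"
  using tet_c_denominator[OF root] unfolding tet_c_def by force

lemma tetY_root_sum: "(\<Sum>i=1..4. 1 / tet_c (lam i) * lam i ^ n) = tetY n"
  by (subst root_sum_eq_gen_tetranacci[where ?d0.0 = "-1" and ?d1.0 = 6
      and ?d2.0 = 0 and ?d3.0 = "-1"])
    (auto simp: tet_c_def)

text \<open>
  The power sums of the four numbers are known as the initial values of \<open>tetT\<close>, \<open>tetU\<close> and \<open>tetW\<close>.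
  As the first power sum is 0, Newton's identities reduce to \<open>p2 = -2 e2\<close> and
  \<open>p4 = 2 e2^2 - 4 e4\<close>, which determine \<open>e4\<close>.
\<close>
lemma prod_tet_c: "tet_c (lam 1) * tet_c (lam 2) * tet_c (lam 3) * tet_c (lam 4) = -1 / 563"
proof -
  define a b c d where "a = tet_c (lam 1)" "b = tet_c (lam 2)" "c = tet_c (lam 3)" "d = tet_c (lam 4)"
  have 1: "a + b + c + d = 0"
    using tetT_root_sum[of 0] unfolding sum_upto_4 by (simp add: a_b_c_d_def)
  have 2: "563 * (a^2 + b^2 + c^2 + d^2) = 40"
    using tetU_root_sum[of 0] unfolding sum_upto_4 by (simp add: a_b_c_d_def)
  have 4: "563^2 * (a^4 + b^4 + c^4 + d^4) = 3052"
    using tetW_root_sum[of 0] unfolding sum_upto_4 by (simp add: a_b_c_d_def)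
  define e2 where "e2 = a*b + a*c + a*d + b*c + b*d + c*d"
  have "1126 * e2 + 40 = 0"
    using 2 unfolding newton_identities_four 1 e2_def[symmetric] by (simp add: neg_eq_iff_add_eq_0)
  then have e2: "e2 = -20 / 563"
    by (simp add: field_simps) algebra
  have "563^2 * (2 * e2^2 - 4 * (a*b*c*d)) = 3052"
    using 4 unfolding newton_identities_four 1 e2_def[symmetric] by simp
  then have "563 * (a*b*c*d) = -1"
    unfolding e2 by (simp add: field_simps power2_eq_square) algebra
  then show ?thesis by (simp add: a_b_c_d_def field_simps)
qed

section \<open>Generating functions as symmetric functions of exponentials\<close>

text \<open>
  The \<open>i\<close>-th exponential in the exponential generating function of \<open>tetT\<close>.
\<close>
definition a :: "nat \<Rightarrow> complex fps" where
  "a i = fps_const (tet_c (lam i)) * fps_exp (lam i)"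

lemma fps_nth_a_power: "fps_nth (a i ^ k) n = tet_c (lam i) ^ k * (of_nat k * lam i) ^ n / fact n"
  by (simp add: a_def power_mult_distrib fps_exp_power_mult fps_const_power)

lemma egf_root_sum:
  assumes "\<And>n. (\<Sum>i=1..4. C * tet_c (lam i) ^ k * lam i ^ n) = s n"
  shows "egf (\<lambda>n. of_nat k ^ n * s n) = fps_const C * (a 1 ^ k + a 2 ^ k + a 3 ^ k + a 4 ^ k)"
  by (rule fps_ext)
    (simp add: fps_nth_a_power power_mult_distrib flip: assms sum_upto_4,
     simp add: sum_upto_4[unfolded One_nat_def] algebra_simps add_divide_distrib)

lemma egf_tetT: "egf tetT = a 1 + a 2 + a 3 + a 4"
  using egf_root_sum[of 1 1 tetT] tetT_root_sum by simp

lemma egf_tetU: "egf (\<lambda>n. 2 ^ n * tetU n) = fps_const 563 * (a 1 ^ 2 + a 2 ^ 2 + a 3 ^ 2 + a 4 ^ 2)"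
  using egf_root_sum[of 563 2 tetU] tetU_root_sum by simp

lemma egf_tetV: "egf (\<lambda>n. 3 ^ n * tetV n) = fps_const 563 * (a 1 ^ 3 + a 2 ^ 3 + a 3 ^ 3 + a 4 ^ 3)"
  using egf_root_sum[of 563 3 tetV] tetV_root_sum by simp

lemma egf_tetW: "egf (\<lambda>n. 4 ^ n * tetW n) = fps_const (563^2) * (a 1 ^ 4 + a 2 ^ 4 + a 3 ^ 4 + a 4 ^ 4)"
  using egf_root_sum[of "563^2" 4 tetW] tetW_root_sum by simp

lemma egf_tetX: "egf (\<lambda>n. 5 ^ n * tetX n) = fps_const (563^2) * (a 1 ^ 5 + a 2 ^ 5 + a 3 ^ 5 + a 4 ^ 5)"
  using egf_root_sum[of "563^2" 5 tetX] tetX_root_sum by simp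

lemma egf_tet_t: "egf tet_t = a 1 * a 2 + a 1 * a 3 + a 1 * a 4 + a 2 * a 3 + a 2 * a 4 + a 3 * a 4"
proof (rule fps_ext)
  fix n
  define e2 where "e2 = a 1 * a 2 + a 1 * a 3 + a 1 * a 4 + a 2 * a 3 + a 2 * a 4 + a 3 * a 4"
  have "tet_t n = 1 / 2 * (fact n * fps_nth (egf tetT * egf tetT) n
      - fact n * fps_nth (egf (\<lambda>n. 2 ^ n * tetU n)) n / 563)"
    by (simp add: tet_t_def mult.assoc flip: binomial_sum_eq_egf)
  also have "\<dots> = 1 / 2 * fact n *
      fps_nth ((a 1 + a 2 + a 3 + a 4)^2 - (a 1 ^ 2 + a 2 ^ 2 + a 3 ^ 2 + a 4 ^ 2)) n"
    unfolding egf_tetT egf_tetU fps_mult_left_const_nth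
    by (simp add: power2_eq_square algebra_simps)
  also have "(a 1 + a 2 + a 3 + a 4)^2 - (a 1 ^ 2 + a 2 ^ 2 + a 3 ^ 2 + a 4 ^ 2) = fps_const 2 * e2"
    unfolding newton_identities_four(1) e2_def by (simp add: numeral_fps_const)
  finally have "fps_nth (egf tet_t) n = fps_nth e2 n"
    by simp
  then show "fps_nth (egf tet_t) n =
      fps_nth (a 1 * a 2 + a 1 * a 3 + a 1 * a 4 + a 2 * a 3 + a 2 * a 4 + a 3 * a 4) n"
    unfolding e2_def .
qed

text \<open>
  The exponents add up to the sum of the roots, which is 1.
\<close>
lemma prod_a: "a 1 * a 2 * a 3 * a 4 = fps_const (-1/563) * fps_exp 1"
proof -
  have "a 1 * a 2 * a 3 * a 4 =
      fps_const (tet_c (lam 1) * tet_c (lam 2) * tet_c (lam 3) * tet_c (lam 4)) *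
      fps_exp (lam 1 + lam 2 + lam 3 + lam 4)"
    by (simp add: a_def fps_exp_add_mult mult_ac flip: fps_const_mult)
  then show ?thesis unfolding prod_tet_c vieta .
qed

text \<open>
  An exponential with nonzero coefficient is a unit. Hence the product of three of the \<open>a j\<close> is
  the product of all four times the inverse of the missing one.
\<close>
lemma a_cofactor:
  assumes "i \<in> {1..4}" and "f * a i = fps_const (-1/563) * fps_exp 1"
  shows "f = fps_const (-1/563) * (fps_exp 1 * (fps_const (1 / tet_c (lam i)) * fps_exp (- lam i)))"
proof -
  let ?b = "fps_const (1 / tet_c (lam i)) * fps_exp (- lam i)"
  have "a i * ?b = fps_const (tet_c (lam i) * (1 / tet_c (lam i))) * fps_exp (lam i + - lam i)"
    by (simp only: fps_exp_add_mult a_def fps_const_mult[symmetric] mult_ac)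
  moreover have "tet_c (lam i) * (1 / tet_c (lam i)) = 1"
    using tet_c_nonzero[OF assms(1)] by simp
  ultimately have "a i * ?b = 1" by simp
  then have "f = f * a i * ?b" by (simp add: mult.assoc)
  then show ?thesis unfolding assms(2) by (simp only: mult.assoc)
qed

text \<open>
  \<open>tetY n\<close> is the sum of \<open>1 / tet_c z * z^n\<close> over the roots \<open>z\<close>, and \<open>1 / tet_c z\<close> is the coefficient of
  \<open>exp (- z x)\<close> in the inverse of the exponential that belongs to \<open>z\<close>.
\<close>
lemma egf_tetY:
  "egf (\<lambda>n. (-1) ^ n * tetY n) * fps_exp 1 =
    fps_const (-563) * (a 1 * a 2 * a 3 + a 1 * a 2 * a 4 + a 1 * a 3 * a 4 + a 2 * a 3 * a 4)"
proof -
  define b where "b i = fps_const (1 / tet_c (lam i)) * fps_exp (- lam i)" for i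
  have Y: "egf (\<lambda>n. (-1) ^ n * tetY n) = b 1 + b 2 + b 3 + b 4"
  proof (rule fps_ext)
    fix n
    have "fps_nth (b 1 + b 2 + b 3 + b 4) n = (\<Sum>i=1..4. fps_nth (b i) n)"
      by (simp only: sum_upto_4 fps_add_nth)
    also have "\<dots> = (\<Sum>i=1..4. (-1) ^ n / fact n * (1 / tet_c (lam i) * lam i ^ n))"
      by (intro sum.cong refl) (simp add: b_def power_minus[of "lam _"])
    also have "\<dots> = (-1) ^ n / fact n * tetY n"
      unfolding sum_distrib_left[symmetric] tetY_root_sum ..
    finally show "fps_nth (egf (\<lambda>n. (-1) ^ n * tetY n)) n = fps_nth (b 1 + b 2 + b 3 + b 4) n"
      by simp
  qed
  have c: "f = fps_const (-1/563) * (fps_exp 1 * b i)"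
    if "i \<in> {1..4}" "f * a i = a 1 * a 2 * a 3 * a 4" for f i
    using a_cofactor[OF that(1)] that(2) unfolding b_def prod_a by simp
  have "a 1 * a 2 * a 3 = fps_const (-1/563) * (fps_exp 1 * b 4)"
    "a 1 * a 2 * a 4 = fps_const (-1/563) * (fps_exp 1 * b 3)"
    "a 1 * a 3 * a 4 = fps_const (-1/563) * (fps_exp 1 * b 2)"
    "a 2 * a 3 * a 4 = fps_const (-1/563) * (fps_exp 1 * b 1)"
    by (rule c; simp add: mult_ac)+
  then have "a 1 * a 2 * a 3 + a 1 * a 2 * a 4 + a 1 * a 3 * a 4 + a 2 * a 3 * a 4
      = fps_const (-1/563) * (fps_exp 1 * egf (\<lambda>n. (-1) ^ n * tetY n))"
    unfolding Y by (simp add: algebra_simps)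
  then have "fps_const (-563) * (a 1 * a 2 * a 3 + a 1 * a 2 * a 4 + a 1 * a 3 * a 4 + a 2 * a 3 * a 4)
      = fps_const (-563 * (-1/563)) * (fps_exp 1 * egf (\<lambda>n. (-1) ^ n * tetY n))"
    by (simp only: fps_const_mult[symmetric] mult.assoc)
  then show ?thesis by (simp add: mult.commute)
qed

end

theorem theorem8:
  fixes lam c :: "nat \<Rightarrow> complex"
    and t1 t3 :: "nat \<Rightarrow> complex"
    and G I J L M N P Q R S :: complex
    and A C E F H K :: complex
    and n :: nat
  assumes lam: "bij_betw lam {1..4} {z. z ^ 4 - z ^ 3 - z ^ 2 - z - 1 = 0}"
    and c: "\<And>i. i \<in> {1..4} \<Longrightarrow> c i = tet_c (lam i)"
    and t1: "egf t1 =
      (\<Sum>(i, j, l) \<in> {(i, j, l). 1 \<le> i \<and> i < j \<and> j < l \<and> l \<le> 4}.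
        fps_const (c i * c j * c l) * fps_exp (lam i + lam j + lam l) *
        (fps_const (c i) * fps_exp (lam i) + fps_const (c j) * fps_exp (lam j)
         + fps_const (c l) * fps_exp (lam l)))"
    and t3: "egf t3 =
      (\<Sum>(i, j, l) \<in> {(i, j, l). 1 \<le> i \<and> i < j \<and> j < l \<and> l \<le> 4}.
        fps_const (c i * c j * c l) * fps_exp (lam i + lam j + lam l) *
        (fps_const ((c i) ^ 2) * fps_exp (2 * lam i) + fps_const ((c j) ^ 2) * fps_exp (2 * lam j)
         + fps_const ((c l) ^ 2) * fps_exp (2 * lam l)))"
    and A: "A = I + 2 * L + 2 * N + P + 2 * Q + 6 * R + 4 * S - 14"
    and C: "C = - G - I - J - 2 * L - M - 2 * P - 3 * Q - 6 * R - 7 * S + 20"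
    and E: "E = - I - 2 * L - N - Q - 3 * R - S + 5"
    and F: "F = 3 * G - J - M + 6 * N + 3 * P + 3 * Q + 12 * R + 9 * S - 30"
    and H: "H = - L - 2 * N - P - Q - 4 * R - 3 * S + 10"
    and K: "K = - 2 * G - 2 * M - 2 * N - 5 * P - 2 * Q - 6 * R - 12 * S + 30"
    and C_nonzero: "C \<noteq> 0"
  shows "C * t3 n =
      (\<Sum>(k1, k2, k3, k4, k5) \<in> {(k1, k2, k3, k4, k5). k1 + k2 + k3 + k4 + k5 = n}.
         multinom n [k1, k2, k3, k4, k5] * tetT k1 * tetT k2 * tetT k3 * tetT k4 * tetT k5)
    - A / 563 ^ 2 * 5 ^ n * tetX n
    - E / 563 ^ 2 * (\<Sum>k=0..n. of_nat (n choose k) * 4 ^ (n - k) * tetW (n - k) * tetT k)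
    + F / 563 * (\<Sum>k=0..n. of_nat (n choose k) * tetT k)
    - G * (\<Sum>k=0..n. of_nat (n choose k) * t1 k * tetT (n - k))
    - H / 563 ^ 2 * (\<Sum>k=0..n. of_nat (n choose k) * 3 ^ (n - k) * 2 ^ k * tetV (n - k) * tetU k)
    - I / 563 * (\<Sum>k=0..n. of_nat (n choose k) * 3 ^ k * tetV k * tet_t (n - k))
    + J / 563 ^ 2 * (\<Sum>(k1, k2, k3) \<in> {(k1, k2, k3). k1 + k2 + k3 = n}.
         multinom n [k1, k2, k3] * (-1) ^ k1 * 2 ^ k2 * tetY k1 * tetU k2)
    + K / 563 * (\<Sum>(k1, k2, k3) \<in> {(k1, k2, k3). k1 + k2 + k3 = n}.
         multinom n [k1, k2, k3] * (-1) ^ k1 * tetY k1 * tet_t k2)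
    - L / 563 * (\<Sum>(k1, k2, k3) \<in> {(k1, k2, k3). k1 + k2 + k3 = n}.
         multinom n [k1, k2, k3] * 3 ^ k1 * tetV k1 * tetT k2 * tetT k3)
    + M / 563 * (\<Sum>(k1, k2, k3, k4) \<in> {(k1, k2, k3, k4). k1 + k2 + k3 + k4 = n}.
         multinom n [k1, k2, k3, k4] * (-1) ^ k1 * tetY k1 * tetT k2 * tetT k3)
    - N / 563 ^ 2 * (\<Sum>(k1, k2, k3) \<in> {(k1, k2, k3). k1 + k2 + k3 = n}.
         multinom n [k1, k2, k3] * 2 ^ k1 * tetU k1 * 2 ^ k2 * tetU k2 * tetT k3)
    - P * (\<Sum>(k1, k2, k3) \<in> {(k1, k2, k3). k1 + k2 + k3 = n}.
         multinom n [k1, k2, k3] * tet_t k1 * tet_t k2 * tetT k3)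
    - Q / 563 * (\<Sum>(k1, k2, k3) \<in> {(k1, k2, k3). k1 + k2 + k3 = n}.
         multinom n [k1, k2, k3] * 2 ^ k1 * tetU k1 * tet_t k2 * tetT k3)
    - R / 563 * (\<Sum>(k1, k2, k3, k4) \<in> {(k1, k2, k3, k4). k1 + k2 + k3 + k4 = n}.
         multinom n [k1, k2, k3, k4] * 2 ^ k1 * tetU k1 * tetT k2 * tetT k3 * tetT k4)
    - S * (\<Sum>(k1, k2, k3, k4) \<in> {(k1, k2, k3, k4). k1 + k2 + k3 + k4 = n}.
         multinom n [k1, k2, k3, k4] * tet_t k1 * tetT k2 * tetT k3 * tetT k4)"
proof -
  interpret tetranacci_roots lam by unfold_locales (rule lam)
  let ?e2 = "a 1 * a 2 + a 1 * a 3 + a 1 * a 4 + a 2 * a 3 + a 2 * a 4 + a 3 * a 4"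
  let ?e3 = "a 1 * a 2 * a 3 + a 1 * a 2 * a 4 + a 1 * a 3 * a 4 + a 2 * a 3 * a 4"
  let ?e4 = "a 1 * a 2 * a 3 * a 4"
  let ?p1 = "a 1 + a 2 + a 3 + a 4"
  let ?p = "\<lambda>k. a 1 ^ k + a 2 ^ k + a 3 ^ k + a 4 ^ k"
  have c': "c 1 = tet_c (lam 1)" "c 2 = tet_c (lam 2)" "c 3 = tet_c (lam 3)" "c 4 = tet_c (lam 4)"
    using c by simp_all
  have m211: "egf t1 = a 1 * a 2 * a 3 * (a 1 + a 2 + a 3) + a 1 * a 2 * a 4 * (a 1 + a 2 + a 4)
      + a 1 * a 3 * a 4 * (a 1 + a 3 + a 4) + a 2 * a 3 * a 4 * (a 2 + a 3 + a 4)"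
    unfolding t1 triple_indices c' a_def fps_exp_add_mult
    by (simp only: fps_const_mult[symmetric] mult_ac)
  have sq: "a i ^ 2 = fps_const (tet_c (lam i) ^ 2) * fps_exp (2 * lam i)" for i
    by (simp add: a_def power_mult_distrib fps_exp_power_mult)
  have m311: "egf t3 = a 1 * a 2 * a 3 * (a 1 ^ 2 + a 2 ^ 2 + a 3 ^ 2)
      + a 1 * a 2 * a 4 * (a 1 ^ 2 + a 2 ^ 2 + a 4 ^ 2)
      + a 1 * a 3 * a 4 * (a 1 ^ 2 + a 3 ^ 2 + a 4 ^ 2)
      + a 2 * a 3 * a 4 * (a 2 ^ 2 + a 3 ^ 2 + a 4 ^ 2)"
    unfolding t3 triple_indices c' sq unfolding a_def fps_exp_add_mult
    by (simp only: fps_const_mult[symmetric] mult_ac)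
  have rel: "fps_const C * egf t3 = ?p1^5 - fps_const A * ?p 5 - fps_const E * (?p 4 * ?p1)
      - fps_const F * (?e4 * ?p1) - fps_const G * (egf t1 * ?p1) - fps_const H * (?p 3 * ?p 2)
      - fps_const I * (?p 3 * ?e2) - fps_const J * (?e3 * ?p 2) - fps_const K * (?e3 * ?e2)
      - fps_const L * (?p 3 * ?p1^2) - fps_const M * (?e3 * ?p1^2) - fps_const N * ((?p 2)^2 * ?p1)
      - fps_const P * (?e2^2 * ?p1) - fps_const Q * (?p 2 * ?e2 * ?p1)
      - fps_const R * (?p 2 * ?p1^3) - fps_const S * (?e2 * ?p1^3)"
    using symmetric_relation[where a = "a 1" and b = "a 2" and c = "a 3" and d = "a 4"
        and G = "fps_const G" and I = "fps_const I" and J = "fps_const J" and L = "fps_const L"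
        and M = "fps_const M" and N = "fps_const N" and P = "fps_const P" and Q = "fps_const Q"
        and R = "fps_const R" and S = "fps_const S"]
    unfolding m211 m311 A C E F H K
    by (simp only: numeral_fps_const fps_const_add fps_const_sub fps_const_neg fps_const_mult)
  \<comment> \<open>\<open>\<Phi>\<close> reads off the sequence from its generating function; opaque, so that the products inside it
    stay as they are.\<close>
  define \<Phi> where "\<Phi> f = fact n * fps_nth f n" for f :: "complex fps"
  have diff: "\<Phi> (f - g) = \<Phi> f - \<Phi> g" for f g
    by (simp add: \<Phi>_def algebra_simps)
  have const: "\<Phi> (fps_const x * f) = x * \<Phi> f" for x f
    by (simp add: \<Phi>_def)
  note binomial = binomial_sum_eq_egf[where n = n, folded \<Phi>_def]
  note multinomial3 = multinomial_sum3_eq_egf[where n = n, folded \<Phi>_def]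
  note multinomial4 = multinomial_sum4_eq_egf[where n = n, folded \<Phi>_def]
  note multinomial5 = multinomial_sum5_eq_egf[where n = n, folded \<Phi>_def]
  \<comment> \<open>The factor \<open>e^x\<close> that turns the reciprocals of the \<open>a i\<close> back into polynomials appears
    in the sums as an index that carries the constant sequence 1.\<close>
  have e3_mult: "fps_const (-563) * (?e3 * f) = egf (\<lambda>n. (-1) ^ n * tetY n) * egf (\<lambda>_. 1) * f" for f
    unfolding mult.assoc[symmetric] egf_tetY[symmetric] egf_one ..
  have e4_mult: "fps_const (-563) * (?e4 * f) = egf (\<lambda>_. 1) * f" for f
  proof -
    have "fps_const (-563) * (?e4 * f) = fps_const (-563 * (-1/563)) * (fps_exp 1 * f)"
      unfolding prod_a by (simp only: fps_const_mult[symmetric] mult.assoc)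
    then show ?thesis by (simp add: egf_one)
  qed
  note egfs = egf_tetT egf_tetU egf_tetV egf_tetW egf_tet_t
  have power5: "f ^ 5 = f * f * f * f * f" for f :: "complex fps"
    by (simp add: eval_nat_numeral mult_ac)
  note ring = fps_const_power[symmetric] power2_eq_square power3_eq_cube power5 mult_ac
  have tX: "5 ^ n * tetX n = \<Phi> (fps_const (563^2) * ?p 5)"
    unfolding egf_tetX[symmetric] by (simp add: \<Phi>_def)
  have tT: "(\<Sum>(k1, k2, k3, k4, k5) \<in> {(k1, k2, k3, k4, k5). k1 + k2 + k3 + k4 + k5 = n}.
      multinom n [k1, k2, k3, k4, k5] * tetT k1 * tetT k2 * tetT k3 * tetT k4 * tetT k5) =
      \<Phi> (?p1^5)"
  proof -
    have eq: "?p1^5 =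
        egf tetT * egf tetT * egf tetT * egf tetT * egf tetT"
      unfolding egfs by (simp only: ring)
    show ?thesis unfolding eq multinomial5[symmetric] by (simp add: mult_ac)
  qed
  have tW: "(\<Sum>k=0..n. of_nat (n choose k) * 4 ^ (n - k) * tetW (n - k) * tetT k) =
      \<Phi> (fps_const (563^2) * (?p 4 * ?p1))"
  proof -
    have eq: "fps_const (563^2) * (?p 4 * ?p1) =
        egf tetT * egf (\<lambda>n. 4 ^ n * tetW n)"
      unfolding egfs by (simp only: ring)
    show ?thesis unfolding eq binomial[symmetric] by (simp add: mult_ac)
  qed
  have tF: "(\<Sum>k=0..n. of_nat (n choose k) * tetT k) =
      \<Phi> (fps_const (-563) * (?e4 * ?p1))"
  proof -
    have eq: "fps_const (-563) * (?e4 * ?p1) =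
        egf tetT * egf (\<lambda>_. 1)"
      unfolding e4_mult egfs by (simp only: ring)
    show ?thesis unfolding eq binomial[symmetric] by (simp add: mult_ac)
  qed
  have tG: "(\<Sum>k=0..n. of_nat (n choose k) * t1 k * tetT (n - k)) =
      \<Phi> (egf t1 * ?p1)"
  proof -
    have eq: "egf t1 * ?p1 =
        egf t1 * egf tetT"
      unfolding egfs by (simp only: ring)
    show ?thesis unfolding eq binomial[symmetric] by (simp add: mult_ac)
  qed
  have tH: "(\<Sum>k=0..n. of_nat (n choose k) * 3 ^ (n - k) * 2 ^ k * tetV (n - k) * tetU k) =
      \<Phi> (fps_const 563 * (fps_const 563 * (?p 3 * ?p 2)))"
  proof -
    have eq: "fps_const 563 * (fps_const 563 * (?p 3 * ?p 2)) =
        egf (\<lambda>n. 2 ^ n * tetU n) * egf (\<lambda>n. 3 ^ n * tetV n)"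
      unfolding egfs by (simp only: ring)
    show ?thesis unfolding eq binomial[symmetric] by (simp add: mult_ac)
  qed
  have tI: "(\<Sum>k=0..n. of_nat (n choose k) * 3 ^ k * tetV k * tet_t (n - k)) =
      \<Phi> (fps_const 563 * (?p 3 * ?e2))"
  proof -
    have eq: "fps_const 563 * (?p 3 * ?e2) =
        egf (\<lambda>n. 3 ^ n * tetV n) * egf tet_t"
      unfolding egfs by (simp only: ring)
    show ?thesis unfolding eq binomial[symmetric] by (simp add: mult_ac)
  qed
  have tJ: "(\<Sum>(k1, k2, k3) \<in> {(k1, k2, k3). k1 + k2 + k3 = n}.
      multinom n [k1, k2, k3] * (-1) ^ k1 * 2 ^ k2 * tetY k1 * tetU k2) =
      \<Phi> (fps_const 563 * (fps_const (-563) * (?e3 * ?p 2)))"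
  proof -
    have eq: "fps_const 563 * (fps_const (-563) * (?e3 * ?p 2)) =
        egf (\<lambda>n. (-1) ^ n * tetY n) * egf (\<lambda>n. 2 ^ n * tetU n) * egf (\<lambda>_. 1)"
      unfolding e3_mult egfs by (simp only: ring)
    show ?thesis unfolding eq multinomial3[symmetric] by (simp add: mult_ac)
  qed
  have tK: "(\<Sum>(k1, k2, k3) \<in> {(k1, k2, k3). k1 + k2 + k3 = n}.
      multinom n [k1, k2, k3] * (-1) ^ k1 * tetY k1 * tet_t k2) =
      \<Phi> (fps_const (-563) * (?e3 * ?e2))"
  proof -
    have eq: "fps_const (-563) * (?e3 * ?e2) =
        egf (\<lambda>n. (-1) ^ n * tetY n) * egf tet_t * egf (\<lambda>_. 1)"
      unfolding e3_mult egfs by (simp only: ring)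
    show ?thesis unfolding eq multinomial3[symmetric] by (simp add: mult_ac)
  qed
  have tL: "(\<Sum>(k1, k2, k3) \<in> {(k1, k2, k3). k1 + k2 + k3 = n}.
      multinom n [k1, k2, k3] * 3 ^ k1 * tetV k1 * tetT k2 * tetT k3) =
      \<Phi> (fps_const 563 * (?p 3 * ?p1^2))"
  proof -
    have eq: "fps_const 563 * (?p 3 * ?p1^2) =
        egf (\<lambda>n. 3 ^ n * tetV n) * egf tetT * egf tetT"
      unfolding egfs by (simp only: ring)
    show ?thesis unfolding eq multinomial3[symmetric] by (simp add: mult_ac)
  qed
  have tM: "(\<Sum>(k1, k2, k3, k4) \<in> {(k1, k2, k3, k4). k1 + k2 + k3 + k4 = n}.
      multinom n [k1, k2, k3, k4] * (-1) ^ k1 * tetY k1 * tetT k2 * tetT k3) =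
      \<Phi> (fps_const (-563) * (?e3 * ?p1^2))"
  proof -
    have eq: "fps_const (-563) * (?e3 * ?p1^2) =
        egf (\<lambda>n. (-1) ^ n * tetY n) * egf tetT * egf tetT * egf (\<lambda>_. 1)"
      unfolding e3_mult egfs by (simp only: ring)
    show ?thesis unfolding eq multinomial4[symmetric] by (simp add: mult_ac)
  qed
  have tN: "(\<Sum>(k1, k2, k3) \<in> {(k1, k2, k3). k1 + k2 + k3 = n}.
      multinom n [k1, k2, k3] * 2 ^ k1 * tetU k1 * 2 ^ k2 * tetU k2 * tetT k3) =
      \<Phi> (fps_const 563 * (fps_const 563 * ((?p 2)^2 * ?p1)))"
  proof -
    have eq: "fps_const 563 * (fps_const 563 * ((?p 2)^2 * ?p1)) =
        egf (\<lambda>n. 2 ^ n * tetU n) * egf (\<lambda>n. 2 ^ n * tetU n) * egf tetT"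
      unfolding egfs by (simp only: ring)
    show ?thesis unfolding eq multinomial3[symmetric] by (simp add: mult_ac)
  qed
  have tP: "(\<Sum>(k1, k2, k3) \<in> {(k1, k2, k3). k1 + k2 + k3 = n}.
      multinom n [k1, k2, k3] * tet_t k1 * tet_t k2 * tetT k3) =
      \<Phi> (?e2^2 * ?p1)"
  proof -
    have eq: "?e2^2 * ?p1 =
        egf tet_t * egf tet_t * egf tetT"
      unfolding egfs by (simp only: ring)
    show ?thesis unfolding eq multinomial3[symmetric] by (simp add: mult_ac)
  qed
  have tQ: "(\<Sum>(k1, k2, k3) \<in> {(k1, k2, k3). k1 + k2 + k3 = n}.
      multinom n [k1, k2, k3] * 2 ^ k1 * tetU k1 * tet_t k2 * tetT k3) =
      \<Phi> (fps_const 563 * (?p 2 * ?e2 * ?p1))"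
  proof -
    have eq: "fps_const 563 * (?p 2 * ?e2 * ?p1) =
        egf (\<lambda>n. 2 ^ n * tetU n) * egf tet_t * egf tetT"
      unfolding egfs by (simp only: ring)
    show ?thesis unfolding eq multinomial3[symmetric] by (simp add: mult_ac)
  qed
  have tR: "(\<Sum>(k1, k2, k3, k4) \<in> {(k1, k2, k3, k4). k1 + k2 + k3 + k4 = n}.
      multinom n [k1, k2, k3, k4] * 2 ^ k1 * tetU k1 * tetT k2 * tetT k3 * tetT k4) =
      \<Phi> (fps_const 563 * (?p 2 * ?p1^3))"
  proof -
    have eq: "fps_const 563 * (?p 2 * ?p1^3) =
        egf (\<lambda>n. 2 ^ n * tetU n) * egf tetT * egf tetT * egf tetT"
      unfolding egfs by (simp only: ring)
    show ?thesis unfolding eq multinomial4[symmetric] by (simp add: mult_ac)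
  qed
  have tS: "(\<Sum>(k1, k2, k3, k4) \<in> {(k1, k2, k3, k4). k1 + k2 + k3 + k4 = n}.
      multinom n [k1, k2, k3, k4] * tet_t k1 * tetT k2 * tetT k3 * tetT k4) =
      \<Phi> (?e2 * ?p1^3)"
  proof -
    have eq: "?e2 * ?p1^3 =
        egf tet_t * egf tetT * egf tetT * egf tetT"
      unfolding egfs by (simp only: ring)
    show ?thesis unfolding eq multinomial4[symmetric] by (simp add: mult_ac)
  qed
  have "C * t3 n = \<Phi> (fps_const C * egf t3)"
    by (simp add: \<Phi>_def)
  then show ?thesis
    unfolding rel tX tT tW tF tG tH tI tJ tK tL tM tN tP tQ tR tS
      mult.assoc[of _ "5 ^ n" "tetX n"] diff const
    by simp
qed

end
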